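(* If $n\ge 7$ is odd, then $w_3=(3n-1)/2$ and $W_3=\{\mathbf{b}_1,\mathbf{b}_3,\mathbf{b}_5\}$, where $\mathbf{b}_1=\overline{10}[n]$, $\mathbf{b}_3=\overline{0}[n-2]\cdot 11$ and $\mathbf{b}_5=11\cdot\overline{0}[n-2]$.
   Context: For $\mathbf{x}=(x_0,\ldots,x_{n-1})\in\mathbb{F}_2^n$, the derivative is $\partial\mathbf{x}=(x_0+x_1,\ldots,x_{n-2}+x_{n-1})\in\mathbb{F}_2^{n-1}$, with $\partial^0\mathbf{x}=\mathbf{x}$ and $\partial^i\mathbf{x}=\partial(\partial^{i-1}\mathbf{x})$. The Steinhaus triangle is $T(\mathbf{x})=(\mathbf{x},\partial\mathbf{x},\ldots,\partial^{n-1}\mathbf{x})$; $|\mathbf{y}|$ is the number of ones of a binary sequence and $|T(\mathbf{x})|=\sum_{i=0}^{n-1}|\partial^i\mathbf{x}|$. For fixed $n$, let $0=w_0<w_1<\cdots<w_m$ be the distinct values of $|T(\mathbf{x})|$ over $\mathbf{x}\in\mathbb{F}_2^n$, and $W_i=\{\mathbf{x}\in\mathbb{F}_2^n:|T(\mathbf{x})|=w_i\}$. Sequences are written as words; a dot denotes concatenation; $\overline{x_1\cdots x_p}[k]$ is the word of the first $k$ letters of the infinite periodic word $x_1\cdots x_px_1\cdots x_p\cdots$. *)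

theory Defs
  imports Complex_Main "HOL-Library.Z2"
begin

text \<open>The field with two elements is the type \<^typ>\<open>bit\<close>; a sequence in its \<open>n\<close>-th power is
  a list of length \<open>n\<close>, with letters indexed from \<open>0\<close>.\<close>

definition binary_seqs :: "nat \<Rightarrow> bit list set" where
  "binary_seqs n = {x. length x = n}"

definition deriv_seq :: "bit list \<Rightarrow> bit list" where
  "deriv_seq x = map (\<lambda>i. x ! i + x ! (i + 1)) [0..<length x - 1]"

definition steinhaus_triangle :: "bit list \<Rightarrow> bit list list" where
  "steinhaus_triangle x = map (\<lambda>i. (deriv_seq ^^ i) x) [0..<length x]"

definition num_ones :: "bit list \<Rightarrow> nat" where
  "num_ones y = card {i. i < length y \<and> y ! i = 1}"

definition triangle_weight :: "bit list \<Rightarrow> nat" where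
  "triangle_weight x = (\<Sum>y\<leftarrow>steinhaus_triangle x. num_ones y)"

definition weight_values :: "nat \<Rightarrow> nat set" where
  "weight_values n = triangle_weight ` binary_seqs n"

text \<open>The \<open>i\<close>-th smallest weight, counted from \<open>0\<close>; it is meaningful only for
  \<open>i < card (weight_values n)\<close>.\<close>

definition steinhaus_w :: "nat \<Rightarrow> nat \<Rightarrow> nat" where
  "steinhaus_w n i = sorted_list_of_set (weight_values n) ! i"

definition steinhaus_W :: "nat \<Rightarrow> nat \<Rightarrow> bit list set" where
  "steinhaus_W n i = {x \<in> binary_seqs n. triangle_weight x = steinhaus_w n i}"

text \<open>The first \<open>k\<close> letters of the infinite periodic word with period \<open>u\<close>, for nonempty \<open>u\<close>.\<close>

definition periodic_prefix :: "bit list \<Rightarrow> nat \<Rightarrow> bit list" where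
  "periodic_prefix u k = map (\<lambda>i. u ! (i mod length u)) [0..<k]"

end

theory Submission
  imports Defs
begin

text \<open>Two consecutive rows of a nonzero triangle contain at least three ones, unless the upper row
  is \<open>10\<dots>0\<close> or \<open>0\<dots>01\<close>. Hence, in passing from length \<open>n\<close> to length \<open>n + 2\<close>, the inequality
  \<open>|T(x)| > (3 n - 1) / 2\<close> is inherited by every other \<open>x\<close> whose second derivative satisfies it.
  What remains are the double antiderivatives of the ten words
  \<open>0\<dots>0\<close>, \<open>1\<dots>1\<close>, \<open>0101\<dots>0\<close>, \<open>1010\<dots>1\<close>, \<open>10\<dots>0\<close>, \<open>010\<dots>0\<close>, \<open>110\<dots>0\<close> and the reversals of the
  last three, and, in passing from \<open>n = 7\<close> to \<open>n = 9\<close>, of the additional word \<open>0001000\<close>.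
  Each has four double antiderivatives, and such an \<open>x\<close> either is again one of the ten words or
  has first two rows that are heavy enough.\<close>

section \<open>Numbers of ones\<close>

lemma num_ones_Nil [simp]: "num_ones [] = 0"
  by (simp add: num_ones_def)

lemma num_ones_eq_length_filter: "num_ones y = length (filter (\<lambda>a. a = 1) y)"
  by (simp add: num_ones_def length_filter_conv_card)

lemma num_ones_Cons [simp]: "num_ones (a # y) = (if a = 1 then 1 else 0) + num_ones y"
  by (simp add: num_ones_eq_length_filter)

lemma num_ones_rev [simp]: "num_ones (rev y) = num_ones y"
  by (simp add: num_ones_eq_length_filter flip: rev_filter)

lemma num_ones_replicate [simp]: "num_ones (replicate k a) = (if a = 1 then k else 0)"
  by (induction k) auto

lemma num_ones_eq_0_iff: "num_ones y = 0 \<longleftrightarrow> y = replicate (length y) 0"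
  by (induction y) auto

section \<open>Derivatives and antiderivatives\<close>

lemma length_deriv_seq [simp]: "length (deriv_seq x) = length x - 1"
  by (simp add: deriv_seq_def)

lemma deriv_seq_Nil [simp]: "deriv_seq [] = []"
  by (simp add: deriv_seq_def)

lemma deriv_seq_single [simp]: "deriv_seq [a] = []"
  by (simp add: deriv_seq_def)

lemma deriv_seq_Cons_Cons [simp]: "deriv_seq (a # b # x) = (a + b) # deriv_seq (b # x)"
proof (rule nth_equalityI)
  fix i assume "i < length (deriv_seq (a # b # x))"
  then show "deriv_seq (a # b # x) ! i = ((a + b) # deriv_seq (b # x)) ! i"
    by (cases i) (simp_all add: deriv_seq_def del: add_bit_eq_xor upt_Suc)
qed (simp add: deriv_seq_def)

lemma deriv_seq_rev: "deriv_seq (rev x) = rev (deriv_seq x)"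
proof (rule nth_equalityI)
  fix i assume "i < length (deriv_seq (rev x))"
  then have "Suc (Suc i) \<le> length x" by simp
  then obtain l where "length x = Suc (Suc (i + l))" by (auto simp: le_iff_add)
  then show "deriv_seq (rev x) ! i = rev (deriv_seq x) ! i"
    by (simp add: deriv_seq_def rev_nth add.commute del: add_bit_eq_xor upt_Suc)
qed simp

lemma deriv_seq_replicate [simp]: "deriv_seq (replicate k a) = replicate (k - 1) 0"
  by (rule nth_equalityI) (simp_all add: deriv_seq_def)

lemma deriv_seq_Cons_replicate [simp]:
  "deriv_seq (a # replicate (Suc k) b) = (a + b) # replicate k 0"
  using deriv_seq_replicate[of "Suc k" b] by simp

text \<open>Partial sums starting from \<open>c\<close> invert the derivative, since addition and
  subtraction agree in the field with two elements. A nonempty word is thus given by its first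
  letter and its derivative.\<close>

fun antideriv :: "bit \<Rightarrow> bit list \<Rightarrow> bit list" where
  "antideriv c [] = [c]"
| "antideriv c (a # y) = c # antideriv (c + a) y"

lemma antideriv_deriv_seq: "x \<noteq> [] \<Longrightarrow> antideriv (hd x) (deriv_seq x) = x"
  by (induction x rule: induct_list012) (auto simp flip: add.assoc)

lemma antideriv_replicate_0 [simp]: "antideriv c (replicate k 0) = replicate (Suc k) c"
  by (induction k) auto

text \<open>The first letter is already a one. This bounds the tail that stays symbolic after
  finitely many letters of an antiderivative have been computed.\<close>

lemma num_ones_antideriv_1: "num_ones (antideriv 1 y) \<ge> Suc 0"
  by (cases y) simp_all

section \<open>Weights of triangles\<close>

lemma triangle_weight_Nil [simp]: "triangle_weight [] = 0"
  by (simp add: triangle_weight_def steinhaus_triangle_def)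

lemma triangle_weight_rec:
  "x \<noteq> [] \<Longrightarrow> triangle_weight x = num_ones x + triangle_weight (deriv_seq x)"
proof -
  assume "x \<noteq> []"
  then obtain k where k: "length x = Suc k" by (cases x) auto
  have "[0..<Suc k] = 0 # map Suc [0..<k]"
    by (simp add: map_Suc_upt upt_conv_Cons del: upt_Suc)
  then show ?thesis
    by (simp add: triangle_weight_def steinhaus_triangle_def k funpow_Suc_right o_def
        del: upt_Suc funpow.simps)
qed

lemma triangle_weight_Cons:
  "triangle_weight (a # x) = num_ones (a # x) + triangle_weight (deriv_seq (a # x))"
  by (rule triangle_weight_rec) simp

lemma triangle_weight_rev [simp]: "triangle_weight (rev x) = triangle_weight x"
proof (induction x rule: measure_induct_rule[of length])
  case (less x)
  show ?case
  proof (cases "x = []")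
    case False
    then have "triangle_weight (rev (deriv_seq x)) = triangle_weight (deriv_seq x)"
      by (intro less.IH) simp
    with False show ?thesis
      by (simp add: triangle_weight_rec[of x] triangle_weight_rec[of "rev x"] deriv_seq_rev)
  qed simp
qed

lemma triangle_weight_replicate_0 [simp]: "triangle_weight (replicate k 0) = 0"
  by (induction k) (simp_all add: triangle_weight_rec del: replicate_Suc)

lemma triangle_weight_replicate_1 [simp]: "triangle_weight (replicate k 1) = k"
  by (cases "k = 0") (simp_all add: triangle_weight_rec)

lemma triangle_weight_1_zeros: "triangle_weight (1 # replicate k 0) = Suc k"
  by (induction k) (simp_all add: triangle_weight_Cons del: replicate_Suc)

text \<open>Differentiation sends \<open>010...0\<close> to \<open>110...0\<close> and back, each
  time one letter shorter, so both weights are found in one induction; every two rows contribute 1 +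
  2 ones.\<close>

lemma triangle_weight_01_11_zeros:
  "triangle_weight (0 # 1 # replicate (Suc (2 * k)) 0) = 3 * k + 3 \<and>
   triangle_weight (1 # 1 # replicate (Suc (2 * k)) 0) = 3 * k + 4"
proof (induction k)
  case 0
  show ?case by (simp add: triangle_weight_Cons)
next
  case (Suc k)
  have *: "deriv_seq (0 # replicate k' 0) = replicate k' 0" for k'
    using deriv_seq_replicate[of "Suc k'" 0] by simp
  show ?case using Suc by (simp add: triangle_weight_Cons *)
qed

section \<open>Alternating words\<close>

lemma periodic_prefix_0 [simp]: "periodic_prefix u 0 = []"
  by (simp add: periodic_prefix_def)

lemma length_periodic_prefix [simp]: "length (periodic_prefix u k) = k"
  by (simp add: periodic_prefix_def)

lemma periodic_prefix_single: "periodic_prefix [a] k = replicate k a"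
  by (rule nth_equalityI) (simp_all add: periodic_prefix_def)

lemma periodic_prefix_pair_Suc [simp]:
  "periodic_prefix [a, b] (Suc k) = a # periodic_prefix [b, a] k"
proof (rule nth_equalityI)
  fix i assume i: "i < length (periodic_prefix [a, b] (Suc k))"
  show "periodic_prefix [a, b] (Suc k) ! i = (a # periodic_prefix [b, a] k) ! i"
  proof (cases i)
    case (Suc j)
    with i have "j < k" by simp
    moreover have "Suc j mod 2 = (if j mod 2 = 0 then 1 else 0)" by presburger
    ultimately show ?thesis using Suc
      by (auto simp: periodic_prefix_def nth_Cons' eval_nat_numeral simp del: upt_Suc)
  qed (simp add: periodic_prefix_def del: upt_Suc)
qed simp

lemma nth_periodic_prefix_pair:
  "i < k \<Longrightarrow> periodic_prefix [a, b] k ! i = (if even i then a else b)"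
proof (induction k arbitrary: a b i)
  case (Suc k)
  then show ?case by (cases i) simp_all
qed simp

lemma deriv_seq_periodic_prefix_pair:
  "deriv_seq (periodic_prefix [a, b] (Suc k)) = replicate k (a + b)"
proof (induction k arbitrary: a b)
  case (Suc k)
  from Suc.IH[of b a] show ?case by (simp add: add.commute[of b a] del: add_bit_eq_xor)
qed simp

lemma antideriv_replicate_1: "antideriv c (replicate k 1) = periodic_prefix [c, c + 1] (Suc k)"
proof (induction k arbitrary: c)
  case (Suc k)
  from Suc.IH[of "c + 1"] show ?case by (simp add: add.assoc)
qed simp

lemma num_ones_periodic_prefix_even:
  "num_ones (periodic_prefix [0, 1] (2 * k)) = k"
  "num_ones (periodic_prefix [1, 0] (2 * k)) = k"
  by (induction k) simp_all

text \<open>The top row has \<open>k\<close> or \<open>k + 1\<close> ones, and its derivative is the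
  all-ones word of length \<open>2 * k\<close>, whose weight is \<open>2 * k\<close>.\<close>

lemma triangle_weight_periodic_prefix:
  "triangle_weight (periodic_prefix [0, 1] (Suc (2 * k))) = 3 * k"
  "triangle_weight (periodic_prefix [1, 0] (Suc (2 * k))) = 3 * k + 1"
proof -
  have "periodic_prefix [a, b] (Suc k') \<noteq> []" for a b :: bit and k' by simp
  note rec = triangle_weight_rec[OF this, unfolded deriv_seq_periodic_prefix_pair]
  show "triangle_weight (periodic_prefix [0, 1] (Suc (2 * k))) = 3 * k"
    "triangle_weight (periodic_prefix [1, 0] (Suc (2 * k))) = 3 * k + 1"
    unfolding rec by (simp_all add: num_ones_periodic_prefix_even)
qed

section \<open>The two-row estimate\<close>

lemma num_ones_add_deriv_seq_ge_3:
  assumes "length x \<ge> 3" "x \<noteq> replicate (length x) 0"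
    "x \<noteq> 1 # replicate (length x - 1) 0" "x \<noteq> replicate (length x - 1) 0 @ [1]"
  shows "num_ones x + num_ones (deriv_seq x) \<ge> 3"
proof -
  \<comment> \<open>A single one that is not at an end differs from both neighbours, so the
    derivative has two ones.\<close>
  have interior: "num_ones (deriv_seq (replicate i 0 @ 0 # 1 # 0 # z)) \<ge> 2" for i z
  proof (induction i)
    case (Suc i)
    then show ?case by (cases i) simp_all
  qed simp
  consider "num_ones x = 0" | "num_ones x = 1" | "num_ones x = 2" | "num_ones x \<ge> 3" by linarith
  then show ?thesis
  proof cases
    case 1
    with assms(2) show ?thesis by (simp add: num_ones_eq_0_iff)
  next
    case 2
    then have "1 \<in> set x" by (auto simp: num_ones_eq_length_filter filter_empty_conv length_Suc_conv
      dest: filter_eq_ConsD)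
    then obtain u v where uv: "x = u @ 1 # v" by (auto simp: in_set_conv_decomp)
    with 2 have "num_ones u = 0" "num_ones v = 0" by (auto simp: num_ones_eq_length_filter)
    then have u: "u = replicate (length u) 0" and v: "v = replicate (length v) 0"
      by (simp_all add: num_ones_eq_0_iff)
    have "u \<noteq> []" "v \<noteq> []" using assms(3,4) u v by (auto simp: uv)
    then obtain i j where "length u = Suc i" "length v = Suc j" by (cases u; cases v) auto
    with u v have "x = replicate i 0 @ 0 # 1 # 0 # replicate j 0"
      using replicate_append_same[of i "0 :: bit"] by (simp add: uv)
    with interior[of i] 2 show ?thesis by simp
  next
    case 3
    \<comment> \<open>With zero derivative \<open>x\<close> would be constant, hence have no ones or
      at least three.\<close>
    have "num_ones (deriv_seq x) \<noteq> 0"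
    proof
      assume "num_ones (deriv_seq x) = 0"
      then have "deriv_seq x = replicate (length x - 1) 0" by (simp add: num_ones_eq_0_iff)
      moreover have "x \<noteq> []" using assms(1) by auto
      ultimately have "x = replicate (length x) (hd x)"
        using antideriv_deriv_seq[of x] by (metis antideriv_replicate_0 length_replicate)
      then have "num_ones x = 0 \<or> num_ones x = length x"
        by (metis num_ones_replicate)
      with 3 assms(1) show False by simp
    qed
    with 3 show ?thesis by simp
  qed simp
qed

section \<open>Light words and the induction on the length\<close>

definition light_half :: "nat \<Rightarrow> bit list set" where
  "light_half m =
    {replicate (2 * m + 1) 0, replicate (2 * m + 1) 1,
     periodic_prefix [0, 1] (2 * m + 1), periodic_prefix [1, 0] (2 * m + 1),
     1 # replicate (2 * m) 0, 0 # 1 # replicate (2 * m - 1) 0, 1 # 1 # replicate (2 * m - 1) 0}"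

text \<open>The first four words of \<open>light_half m\<close> are palindromes, their length being
  odd, so only the mirror images of the last three are added. Case analyses then need seven words
  instead of ten.\<close>

definition light :: "nat \<Rightarrow> bit list set" where
  "light m = light_half m \<union> rev ` light_half m"

lemma mem_light_iff: "x \<in> light m \<longleftrightarrow> x \<in> light_half m \<or> rev x \<in> light_half m"
  by (force simp: light_def)

lemma rev_mem_light_iff [simp]: "rev x \<in> light m \<longleftrightarrow> x \<in> light m"
  by (auto simp: mem_light_iff)

text \<open>The second derivative and the first letters \<open>c\<close> of \<open>x\<close> and
  \<open>b\<close> of \<open>deriv_seq x\<close> determine \<open>x\<close>, which leaves four words
  per case. The bound is \<open>3 * (m + 1) + 1\<close>, matching length
  \<open>2 * (m + 1) + 1\<close>.\<close>

lemma double_antideriv_light_half: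
  assumes "length x = 2 * m + 3" "m \<ge> 3"
    "deriv_seq (deriv_seq x) \<in> light_half m \<union> {[0, 0, 0, 1, 0, 0, 0]}"
  shows "x \<in> light (m + 1) \<or> triangle_weight x > 3 * m + 4"
proof -
  define y where "y = deriv_seq (deriv_seq x)"
  define b where "b = hd (deriv_seq x)"
  define c where "c = hd x"
  from assms(2) obtain j where m: "m = j + 3" using le_Suc_ex add.commute by metis
  have "x \<noteq> []" "deriv_seq x \<noteq> []" using assms(1) by (auto simp flip: length_greater_0_conv)
  then have dx: "deriv_seq x = antideriv b y" and x: "x = antideriv c (antideriv b y)"
    by (simp_all add: y_def b_def c_def antideriv_deriv_seq)
  have "triangle_weight x = num_ones x + (num_ones (deriv_seq x) + triangle_weight y)"
    using \<open>x \<noteq> []\<close> \<open>deriv_seq x \<noteq> []\<close> by (simp add: triangle_weight_rec y_def)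
  then have w: "triangle_weight x = num_ones (antideriv c (antideriv b y))
      + (num_ones (antideriv b y) + triangle_weight y)"
    by (metis dx x)
  \<comment> \<open>Since \<open>m \<ge> 3\<close>, seven letters of \<open>y\<close> can be
    unfolded; with the bound on the tail they yield enough ones in cases 2 to 4.\<close>
  have N: "2 * m + 1 = Suc (Suc (Suc (Suc (Suc (Suc (Suc (2 * j)))))))"
    by (simp add: m)
  \<comment> \<open>Lengths become successors of \<open>M\<close>, which avoids truncated
    subtraction when words are compared letter by letter.\<close>
  define M where "M = 2 * m - 1"
  have M: "2 * m = Suc M" "2 * m - 1 = M" "m + m = Suc M" using assms(2) by (simp_all add: M_def)
  have L: "light_half (Suc m) =
    {replicate (Suc (Suc (Suc (Suc M)))) 0, replicate (Suc (Suc (Suc (Suc M)))) 1,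
     periodic_prefix [0, 1] (Suc (Suc (Suc (Suc M)))),
     periodic_prefix [1, 0] (Suc (Suc (Suc (Suc M)))),
     1 # replicate (Suc (Suc (Suc M))) 0, 0 # 1 # replicate (Suc (Suc M)) 0,
     1 # 1 # replicate (Suc (Suc M)) 0}"
    by (simp add: light_half_def M)
  consider "y = replicate (2 * m + 1) 0" | "y = replicate (2 * m + 1) 1"
    | "y = periodic_prefix [0, 1] (2 * m + 1)" | "y = periodic_prefix [1, 0] (2 * m + 1)"
    | "y = 1 # replicate (2 * m) 0" | "y = 0 # 1 # replicate (2 * m - 1) 0"
    | "y = 1 # 1 # replicate (2 * m - 1) 0" | "y = [0, 0, 0, 1, 0, 0, 0]"
    using assms(3) by (auto simp: y_def light_half_def)
  then have "antideriv c (antideriv b y) \<in> light_half (m + 1) \<or> triangle_weight x > 3 * m + 4"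
  proof cases
    case 1
    then show ?thesis by (cases b; cases c; simp add: L M antideriv_replicate_1)
  next
    case 2
    then have "triangle_weight y = 2 * m + 1"
      by (simp only: triangle_weight_replicate_1)
    \<comment> \<open>This row alternates and has even length \<open>2 * m + 2\<close>.\<close>
    moreover have "num_ones (antideriv b y) = m + 1"
      using num_ones_periodic_prefix_even[of "m + 1"] unfolding 2 antideriv_replicate_1
      by (cases b) simp_all
    moreover have "num_ones (antideriv c (antideriv b y)) \<ge> 3"
      unfolding 2 N by (cases b; cases c; simp add: trans_le_add1 num_ones_antideriv_1)
    ultimately show ?thesis using w by simp
  next
    case 3
    then have "triangle_weight y = 3 * m"
      using triangle_weight_periodic_prefix[of m] by simp
    \<comment> \<open>The bounds 5 here and 4 in the next case raise the weights
      \<open>3 * m\<close> and \<open>3 * m + 1\<close> of \<open>y\<close> to at least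
      \<open>3 * m + 5\<close>.\<close>
    moreover have "num_ones (antideriv c (antideriv b y)) + num_ones (antideriv b y) \<ge> 5"
      unfolding 3 N by (cases b; cases c; simp add: trans_le_add1 num_ones_antideriv_1)
    ultimately show ?thesis using w by simp
  next
    case 4
    then have "triangle_weight y = 3 * m + 1"
      using triangle_weight_periodic_prefix[of m] by simp
    moreover have "num_ones (antideriv c (antideriv b y)) + num_ones (antideriv b y) \<ge> 4"
      unfolding 4 N by (cases b; cases c; simp add: trans_le_add1 num_ones_antideriv_1)
    ultimately show ?thesis using w by simp
  next
    case 5
    then have "triangle_weight y = 2 * m + 1"
      using triangle_weight_1_zeros[of "2 * m"] by simp
    with w assms(2) M(3) show ?thesis unfolding 5 M(1)
      by (cases b; cases c; simp add: L antideriv_replicate_1)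
  next
    case 6
    then have "triangle_weight y = 3 * m"
      using triangle_weight_01_11_zeros[of "j + 2"] by (simp add: m eval_nat_numeral)
    with w assms(2) M(3) show ?thesis unfolding 6 M(2)
      by (cases b; cases c; simp add: L antideriv_replicate_1)
  next
    case 7
    then have "triangle_weight y = 3 * m + 1"
      using triangle_weight_01_11_zeros[of "j + 2"] by (simp add: m eval_nat_numeral)
    with w assms(2) M(3) show ?thesis unfolding 7 M(2)
      by (cases b; cases c; simp add: L antideriv_replicate_1)
  next
    case 8
    with assms(1) have "m = 3" using arg_cong[OF y_def, of length] by simp
    with w show ?thesis unfolding 8
      by (cases b; cases c; simp add: triangle_weight_Cons)
  qed
  with x show ?thesis by (auto simp: light_def)
qed

text \<open>Evaluation of all 128 words. Outside \<open>light 3\<close>, only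
  \<open>0001000\<close>, of weight 9, stays within the bound.\<close>

lemma light_or_heavy_7:
  assumes "length x = 7"
  shows "x \<in> light 3 \<union> {[0, 0, 0, 1, 0, 0, 0]} \<or> triangle_weight x > 10"
proof -
  from assms obtain a b c d e f g where x: "x = [a, b, c, d, e, f, g]"
    by (auto simp: numeral_eq_Suc length_Suc_conv)
  show ?thesis unfolding x
    by (cases a; cases b; cases c; cases d; cases e; cases f; cases g;
        simp add: triangle_weight_Cons light_def light_half_def numeral_eq_Suc)
qed

lemma light_or_heavy:
  assumes "m \<ge> 3" "length x = 2 * m + 1"
  shows "x \<in> light m \<union> {[0, 0, 0, 1, 0, 0, 0]} \<or> triangle_weight x > 3 * m + 1"
  using assms
proof (induction m arbitrary: x rule: dec_induct)
  case base
  then show ?case using light_or_heavy_7[of x] by simp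
next
  case (step m)
  let ?y = "deriv_seq (deriv_seq x)"
  have len: "length x = 2 * m + 3" using step.prems by simp
  then have "length ?y = 2 * m + 1" by simp
  from step.IH[OF this] consider
      "?y \<in> light_half m \<union> {[0, 0, 0, 1, 0, 0, 0]}" | "rev ?y \<in> light_half m"
    | "triangle_weight ?y > 3 * m + 1"
    by (auto simp only: mem_light_iff Un_iff)
  then show ?case
  proof cases
    case 1
    from double_antideriv_light_half[OF len step.hyps(1) this] show ?thesis by auto
  next
    case 2
    \<comment> \<open>Reversal commutes with the derivative and preserves weights, so
      \<open>rev x\<close> can replace \<open>x\<close>.\<close>
    then have "deriv_seq (deriv_seq (rev x)) \<in> light_half m" by (simp add: deriv_seq_rev)
    with double_antideriv_light_half[of "rev x" m] len step.hyps(1) show ?thesis by auto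
  next
    case 3
    show ?thesis
    proof (cases "x \<in> light (m + 1)")
      case False
      have r: "rev (1 # replicate k (0 :: bit)) = replicate k 0 @ [1]" for k by simp
      \<comment> \<open>The words excluded from the two-row estimate are themselves light.\<close>
      have "{replicate (2 * m + 3) 0, 1 # replicate (2 * m + 2) 0} \<subseteq> light_half (m + 1)"
        by (simp add: light_half_def numeral_eq_Suc)
      moreover from this have "replicate (2 * m + 2) 0 @ [1] \<in> light (m + 1)"
        unfolding light_def r[symmetric] by blast
      ultimately have "x \<noteq> replicate (2 * m + 3) 0" "x \<noteq> 1 # replicate (2 * m + 2) 0"
        "x \<noteq> replicate (2 * m + 2) 0 @ [1]" using False by (auto simp: light_def)
      then have "num_ones x + num_ones (deriv_seq x) \<ge> 3"
        using num_ones_add_deriv_seq_ge_3[of x] len by simp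
      moreover have "x \<noteq> []" "deriv_seq x \<noteq> []"
        using len by (auto simp flip: length_greater_0_conv)
      ultimately show ?thesis using 3 by (simp add: triangle_weight_rec)
    qed simp
  qed
qed

section \<open>The smallest weights and the words of weight \<open>3 * m + 1\<close>\<close>

lemma triangle_weight_light_half:
  assumes "m \<ge> 1" "x \<in> light_half m"
  shows "triangle_weight x \<in> {0, 2 * m + 1, 3 * m} \<or>
    triangle_weight x = 3 * m + 1 \<and>
    x \<in> {periodic_prefix [1, 0] (2 * m + 1), 1 # 1 # replicate (2 * m - 1) 0}"
proof -
  from assms(1) obtain k where m: "m = Suc k" by (cases m) auto
  \<comment> \<open>The weight is 0 for the zero word, \<open>2 * m + 1\<close> for
    \<open>1...1\<close> and \<open>10...0\<close>, \<open>3 * m\<close> for \<open>01...0\<close>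
    and \<open>010...0\<close>, and \<open>3 * m + 1\<close> for \<open>10...1\<close> and
    \<open>110...0\<close>.\<close>
  show ?thesis
    using assms(2) triangle_weight_periodic_prefix[of m] triangle_weight_01_11_zeros[of k]
      triangle_weight_1_zeros[of "2 * m"] triangle_weight_replicate_1[of "2 * m + 1"]
      triangle_weight_replicate_0[of "2 * m + 1"]
    unfolding light_half_def by (auto simp: m simp del: replicate_Suc periodic_prefix_pair_Suc)
qed

text \<open>The positions \<open>i\<close> and \<open>2 * m - i\<close> have the same
  parity.\<close>

lemma rev_periodic_prefix_odd:
  "rev (periodic_prefix [a, b] (2 * m + 1)) = periodic_prefix [a, b] (2 * m + 1)"
proof (rule nth_equalityI)
  fix i assume "i < length (rev (periodic_prefix [a, b] (2 * m + 1)))"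
  then have i: "i < 2 * m + 1" by simp
  then have "i \<le> 2 * m" by simp
  then obtain d where d: "2 * m = i + d" unfolding le_iff_add by blast
  then have "even d \<longleftrightarrow> even i" by presburger
  with i show "rev (periodic_prefix [a, b] (2 * m + 1)) ! i = periodic_prefix [a, b] (2 * m + 1) ! i"
    by (simp add: rev_nth nth_periodic_prefix_pair d del: periodic_prefix_pair_Suc)
qed simp

text \<open>A sorted list without repetitions is determined by its set, so \<open>a, b, c, d\<close>
  followed by the sorted larger elements is the whole list.\<close>

lemma sorted_list_of_set_nth_3:
  fixes A :: "nat set"
  assumes "finite A" "{a, b, c, d} \<subseteq> A" "a < b" "b < c" "c < d"
    "\<And>z. z \<in> A \<Longrightarrow> z \<in> {a, b, c} \<or> d \<le> z"
  shows "sorted_list_of_set A ! 3 = d"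
proof -
  let ?B = "{z \<in> A. d < z}"
  have "sorted_list_of_set A = [a, b, c, d] @ sorted_list_of_set ?B"
  proof (rule sorted_distinct_set_unique)
    show "set (sorted_list_of_set A) = set ([a, b, c, d] @ sorted_list_of_set ?B)"
      using assms by force
  qed (use assms in auto)
  then show ?thesis by simp
qed

theorem theorem6p1:
  fixes n :: nat
  assumes "n \<ge> 7" and "odd n"
  shows "3 < card (weight_values n)
    \<and> real (steinhaus_w n 3) = (3 * real n - 1) / 2
    \<and> steinhaus_W n 3 =
        {periodic_prefix [1, 0] n,
         periodic_prefix [0] (n - 2) @ [1, 1],
         [1, 1] @ periodic_prefix [0] (n - 2)}"
proof -
  \<comment> \<open>In terms of \<open>m\<close>, the claimed value \<open>(3 * n - 1) / 2\<close>
    is \<open>3 * m + 1\<close>.\<close>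
  from assms obtain m where n: "n = 2 * m + 1" and m: "m \<ge> 3" by (auto elim!: oddE)
  then obtain k where k: "m = Suc k" by (cases m) auto
  let ?p = "periodic_prefix [1, 0] n" and ?l = "1 # 1 # replicate (n - 2) (0 :: bit)"
  let ?r = "replicate (n - 2) (0 :: bit) @ [1, 1]"
  have r: "?r = rev ?l" by simp
  have n2: "n - 2 = 2 * m - 1" by (simp add: n)
  have W: "triangle_weight (replicate n 0) = 0" "triangle_weight (replicate n 1) = n"
    "triangle_weight (periodic_prefix [0, 1] n) = 3 * m" "triangle_weight ?p = 3 * m + 1"
    "triangle_weight ?l = 3 * m + 1" "triangle_weight ?r = 3 * m + 1"
    using triangle_weight_periodic_prefix[of m] triangle_weight_01_11_zeros[of k]
    unfolding r by (simp_all add: n k triangle_weight_replicate_1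
      del: replicate_Suc periodic_prefix_pair_Suc rev.simps)
  have half: "triangle_weight x \<in> {0, n, 3 * m} \<or> triangle_weight x = 3 * m + 1 \<and> x \<in> {?p, ?l}"
    if "x \<in> light_half m" for x
    using triangle_weight_light_half[OF _ that] m unfolding n2 unfolding n by linarith
  have upper: "triangle_weight x \<in> {0, n, 3 * m} \<or> triangle_weight x > 3 * m + 1 \<or>
      triangle_weight x = 3 * m + 1 \<and> x \<in> {?p, ?r, ?l}" if "length x = n" for x
  proof -
    from light_or_heavy[OF m] that consider "x \<in> light_half m" | "rev x \<in> light_half m"
      | "x = [0, 0, 0, 1, 0, 0, 0]" | "triangle_weight x > 3 * m + 1"
      by (auto simp only: n mem_light_iff Un_iff insert_iff empty_iff)
    then show ?thesis
    proof cases
      case 1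
      then show ?thesis using half[of x] by blast
    next
      case 2
      \<comment> \<open>Reversal fixes \<open>?p\<close> and exchanges \<open>?l\<close> with
        \<open>?r\<close>; this is how the third word of weight \<open>3 * m + 1\<close>
        enters.\<close>
      have "rev ?p = ?p" unfolding n by (rule rev_periodic_prefix_odd)
      then have "rev x = ?p \<longrightarrow> x = ?p" "rev x = ?l \<longrightarrow> x = ?r"
        unfolding r by (metis rev_rev_ident)+
      then show ?thesis using half[OF 2] unfolding triangle_weight_rev insert_iff empty_iff by argo
    next
      case 3
      \<comment> \<open>The weight 9 of \<open>0001000\<close> equals \<open>3 * m\<close>, a value
        already listed.\<close>
      with that have "m = 3" by (simp add: n)
      with 3 show ?thesis by (simp add: triangle_weight_Cons n)
    qed simp
  qed
  have mem: "z \<in> weight_values n \<longleftrightarrow> (\<exists>x. length x = n \<and> triangle_weight x = z)" for z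
    by (auto simp: weight_values_def binary_seqs_def)
  have univ: "finite (UNIV :: bit set)" by (rule finite_subset[of _ "{0, 1}"]) auto
  have fin: "finite (weight_values n)"
    unfolding weight_values_def binary_seqs_def
    using finite_lists_length_eq[OF univ, of n] by simp
  have sub: "{0, n, 3 * m, 3 * m + 1} \<subseteq> weight_values n"
    unfolding mem insert_subset using W by (metis empty_subsetI length_periodic_prefix length_replicate)
  have ord: "0 < n" "n < 3 * m" "3 * m < 3 * m + 1" using m by (simp_all add: n)
  have "card {0, n, 3 * m, 3 * m + 1} = 4" using ord by simp
  with card_mono[OF fin sub] have "3 < card (weight_values n)" by simp
  moreover have w3: "steinhaus_w n 3 = 3 * m + 1"
    unfolding steinhaus_w_def
    by (rule sorted_list_of_set_nth_3[OF fin sub ord]) (use upper in \<open>force simp: mem\<close>)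
  moreover have "steinhaus_W n 3 = {?p, ?r, ?l}"
  proof -
    have "length ?l = n" "length ?r = n" using assms(1) by simp_all
    with upper W ord show ?thesis
      unfolding steinhaus_W_def binary_seqs_def w3 by fastforce
  qed
  ultimately show ?thesis by (simp add: n periodic_prefix_single)
qed

end
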